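(* Let $1\le p\le\infty$ and $f\in X^{p}$. Then, for positive integers $m\le n$, at every $X^{p}$-point $x$ of $f$, $$\left|\sigma_{n,m}f(x)-f(x)\right| = o_x(1)\left[1+\ln\frac{n+1}{m+1}\right]\quad\text{as } n\to\infty,$$ that is, for each $X^p$-point $x$ of $f$ there is a sequence $\varepsilon_n=\varepsilon_n(x)\to 0$ such that $|\sigma_{n,m}f(x)-f(x)|\le \varepsilon_n\left[1+\ln\frac{n+1}{m+1}\right]$ for all positive integers $m\le n$.
   Context: For $1\le p<\infty$, $X^p=L^p$ is the class of all $2\pi$-periodic real-valued functions integrable in the Lebesgue sense with $p$-th power over $[-\pi,\pi]$; for $p=\infty$, $X^p=C$ is the class of all continuous $2\pi$-periodic real-valued functions. A real $x$ is an $X^p$-point of $f$ if: for $1\le p<\infty$, $x$ is a Lebesgue point of order $p$ ($L^p$-point), i.e. $\lim_{h\to0+}\frac{1}{2h}\int_{-h}^{h}|f(x+t)-f(x)|^p\,dt=0$; for $p=\infty$, $x$ is a point of continuity of $f$ ($C$-point). $S_kf$ denotes the $k$-th partial sum of the trigonometric Fourier series $\frac{a_0(f)}{2}+\sum_{k=1}^{\infty}(a_k(f)\cos kx+b_k(f)\sin kx)$ of $f$, and for $0\le m\le n$ the de la Vallée-Poussin means are $\sigma_{n,m}f(x)=\frac{1}{m+1}\sum_{k=n-m}^{n}S_kf(x)$. *)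

theory Defs
  imports "HOL-Analysis.Analysis"
begin

text \<open>The exponent ranges over \<open>1 \<le> p \<le> \<infinity>\<close> in the type \<^typ>\<open>ennreal\<close>. Elements of the classes are
  functions, not equivalence classes modulo null sets, so that the value \<open>f x\<close> is meaningful.\<close>

definition X_space :: "ennreal \<Rightarrow> (real \<Rightarrow> real) set" where
  "X_space p = {f. (\<forall>x. f (x + 2 * pi) = f x) \<and>
     (if p = \<infinity> then continuous_on UNIV f
      else f \<in> borel_measurable (lebesgue_on {-pi..pi}) \<and>
           integrable (lebesgue_on {-pi..pi}) (\<lambda>t. \<bar>f t\<bar> powr enn2real p))}"

definition X_point :: "ennreal \<Rightarrow> (real \<Rightarrow> real) \<Rightarrow> real \<Rightarrow> bool" where
  "X_point p f x \<longleftrightarrow>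
     (if p = \<infinity> then isCont f x
      else ((\<lambda>h. 1 / (2 * h) *
               (LINT t|lebesgue_on {-h..h}. \<bar>f (x + t) - f x\<bar> powr enn2real p))
             \<longlongrightarrow> 0) (at_right 0))"

definition fourier_cos_coeff :: "(real \<Rightarrow> real) \<Rightarrow> nat \<Rightarrow> real" where
  "fourier_cos_coeff f k = 1 / pi * (LINT t|lebesgue_on {-pi..pi}. f t * cos (real k * t))"

definition fourier_sin_coeff :: "(real \<Rightarrow> real) \<Rightarrow> nat \<Rightarrow> real" where
  "fourier_sin_coeff f k = 1 / pi * (LINT t|lebesgue_on {-pi..pi}. f t * sin (real k * t))"

definition fourier_sum :: "nat \<Rightarrow> (real \<Rightarrow> real) \<Rightarrow> real \<Rightarrow> real" where
  "fourier_sum n f x = fourier_cos_coeff f 0 / 2 +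
     (\<Sum>k=1..n. fourier_cos_coeff f k * cos (real k * x) + fourier_sin_coeff f k * sin (real k * x))"

text \<open>Meant for \<open>m \<le> n\<close>; otherwise the subtraction below is truncated.\<close>

definition vallee_poussin_mean :: "nat \<Rightarrow> nat \<Rightarrow> (real \<Rightarrow> real) \<Rightarrow> real \<Rightarrow> real" where
  "vallee_poussin_mean n m f x = 1 / (real m + 1) * (\<Sum>k=n-m..n. fourier_sum k f x)"

end

theory Submission
  imports Defs
begin

text \<open>
  Write \<open>N = n + 1\<close> and \<open>M = m + 1\<close>. The error \<open>\<sigma>\<^sub>n\<^sub>,\<^sub>m f x - f x\<close> is \<open>1 / \<pi>\<close> times the integral of
  \<open>f (x + u) - f x\<close> against the averaged Dirichlet kernel \<open>V\<close>, which satisfies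
  \<open>\<bar>V u\<bar> \<le> min N (min (2 / \<bar>u\<bar>) (8 / (M u\<^sup>2)))\<close>. For every exponent, an \<open>X\<^sup>p\<close>-point is a Lebesgue point of
  order 1. Near \<open>0\<close>, dominate \<open>\<bar>V\<bar>\<close> by a combination of indicators of the intervals
  \<open>[-2\<^sup>j / N, 2\<^sup>j / N]\<close>: each contributes \<open>o(1) min 1 (N / (M 2\<^sup>j))\<close>, and these sum to
  \<open>o(1) (1 + ln (N / M))\<close>. Away from \<open>0\<close> the kernel is \<open>O(1 / M)\<close>, which the weight also absorbs.
\<close>

section \<open>Integrals of periodic functions over arbitrary intervals\<close>

lemma absolutely_integrable_shift_real_ivl:
  fixes f :: "real \<Rightarrow> real"
  assumes "f absolutely_integrable_on {a..b}"
  shows "(\<lambda>x. f (x + c)) absolutely_integrable_on {a - c..b - c}"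
  using assms integrable_shift_real_ivl[of f a b c] integrable_shift_real_ivl[of "\<lambda>x. norm (f x)" a b c]
  by (simp add: absolutely_integrable_on_def)

text \<open>Translates by one period to either side enlarge the interval of integrability step by
  step until it contains \<open>{a..b}\<close>.\<close>

lemma absolutely_integrable_periodic:
  fixes f :: "real \<Rightarrow> real"
  assumes per: "\<And>x. f (x + 2 * pi) = f x" and f: "f absolutely_integrable_on {-pi..pi}"
  shows "f absolutely_integrable_on {a..b}"
proof -
  have per': "f (x - 2 * pi) = f x" for x
    using per[of "x - 2 * pi"] by simp
  have *: "f absolutely_integrable_on {- pi - 2 * pi * real k..pi + 2 * pi * real k}" for k
  proof (induction k)
    case 0
    then show ?case using f by simp
  next
    case (Suc k)
    let ?l = "- pi - 2 * pi * real k" and ?r = "pi + 2 * pi * real k"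
    have "f absolutely_integrable_on {?l - 2 * pi..?r - 2 * pi} \<union> {?l..?r} \<union> {?l + 2 * pi..?r + 2 * pi}"
      using absolutely_integrable_shift_real_ivl[OF Suc, of "2 * pi"]
        absolutely_integrable_shift_real_ivl[OF Suc, of "-2 * pi"] Suc
      by (auto simp: per per' intro!: absolutely_integrable_Un)
    moreover have "{- pi - 2 * pi * real (Suc k)..pi + 2 * pi * real (Suc k)} =
        {?l - 2 * pi..?r - 2 * pi} \<union> {?l..?r} \<union> {?l + 2 * pi..?r + 2 * pi}"
    proof -
      \<comment> \<open>Here \<open>c\<close> stands for \<open>pi\<close> and \<open>q\<close> for
        \<open>2 * pi * real k\<close>. The translates leave no gap because the old length
        \<open>2 * c + 2 * q\<close> is at least the shift \<open>2 * c\<close>.\<close>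
      have *: "{- c - q - 2 * c..c + q + 2 * c}
          = {- c - q - 2 * c..c + q - 2 * c} \<union> {- c - q..c + q} \<union> {- c - q + 2 * c..c + q + 2 * c}"
        if "0 \<le> q" "0 < c" for q c :: real
        using that by auto
      have "- pi - 2 * pi * real (Suc k) = ?l - 2 * pi" "pi + 2 * pi * real (Suc k) = ?r + 2 * pi"
        by (simp_all add: algebra_simps)
      then show ?thesis
        using *[of "2 * pi * real k" pi] by (simp only:) simp
    qed
    ultimately show ?case by (simp only:)
  qed
  obtain k :: nat where k: "\<bar>a\<bar> + \<bar>b\<bar> \<le> real k"
    using real_arch_simple by blast
  have "real k \<le> 2 * pi * real k"
    using mult_right_mono[of 1 "2 * pi" "real k"] pi_gt3 by simp
  then have "{a..b} \<subseteq> {- pi - 2 * pi * real k..pi + 2 * pi * real k}"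
    using k pi_ge_zero by (smt (verit) atLeastatMost_subset_iff)
  then show ?thesis
    using absolutely_integrable_on_subinterval[OF *] by blast
qed

text \<open>Moving the window to the right by \<open>x\<close> loses \<open>{-pi..x - pi}\<close>
  and gains \<open>{pi..x + pi}\<close>, and these two pieces differ by one period.\<close>

lemma integral_periodic_shift:
  fixes f :: "real \<Rightarrow> real"
  assumes per: "\<And>x. f (x + 2 * pi) = f x" and f: "f absolutely_integrable_on {-pi..pi}"
  shows "integral {-pi..pi} (\<lambda>u. f (x + u)) = integral {-pi..pi} f"
proof -
  have main: "integral {-pi..pi} (\<lambda>u. g (x + u)) = integral {-pi..pi} g"
    if per: "\<And>x. g (x + 2 * pi) = g x" and g: "g absolutely_integrable_on {-pi..pi}" and "x \<ge> 0"
    for g :: "real \<Rightarrow> real" and x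
  proof -
    have int: "g integrable_on {a..b}" for a b
      using absolutely_integrable_periodic[OF per g, of a b] by (simp add: absolutely_integrable_on_def)
    have "integral {-pi..pi} (\<lambda>u. g (x + u)) = integral {x - pi..x + pi} g"
      using integral_shift_real_ivl[of "x - pi" x "x + pi" g] by (simp add: add.commute)
    moreover have "integral {-pi..x - pi} g = integral {pi..x + pi} g"
      using integral_shift_real_ivl[of pi "2 * pi" "x + pi" g] by (simp add: per)
    moreover have "integral {-pi..x - pi} g + integral {x - pi..x + pi} g = integral {-pi..x + pi} g"
      using \<open>x \<ge> 0\<close> int pi_gt_zero by (intro Henstock_Kurzweil_Integration.integral_combine) auto
    moreover have "integral {-pi..pi} g + integral {pi..x + pi} g = integral {-pi..x + pi} g"
      using \<open>x \<ge> 0\<close> int by (intro Henstock_Kurzweil_Integration.integral_combine) auto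
    ultimately show ?thesis by simp
  qed
  show ?thesis
  proof (cases "x \<ge> 0")
    case True
    then show ?thesis using main assms by blast
  next
    case False
    \<comment> \<open>For negative \<open>x\<close> the roles are exchanged: \<open>main\<close> is
      applied to the translated function with shift \<open>- x\<close>, which undoes the
      translation.\<close>
    have "(\<lambda>u. f (x + u)) absolutely_integrable_on {-pi..pi}"
      using absolutely_integrable_shift_real_ivl[OF absolutely_integrable_periodic[OF assms, of "x - pi" "x + pi"], of x]
      by (simp add: add.commute)
    moreover have "f (x + (y + 2 * pi)) = f (x + y)" for y
      using per[of "x + y"] by (simp add: add.assoc)
    ultimately show ?thesis
      using main[of "\<lambda>u. f (x + u)" "- x"] False by simp
  qed
qed

section \<open>The Dirichlet kernel, its averages, and their pointwise bounds\<close>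

definition dirichlet_kernel :: "nat \<Rightarrow> real \<Rightarrow> real" where
  "dirichlet_kernel k u = 1 / 2 + (\<Sum>j=1..k. cos (real j * u))"

definition vp_kernel :: "nat \<Rightarrow> nat \<Rightarrow> real \<Rightarrow> real" where
  "vp_kernel n m u = 1 / (real m + 1) * (\<Sum>k=n-m..n. dirichlet_kernel k u)"

text \<open>The sum telescopes, since \<open>2 * sin (u / 2) * cos (j * u)\<close> is the difference
  of \<open>sin ((j + 1 / 2) * u)\<close> and \<open>sin ((j - 1 / 2) * u)\<close>.\<close>

lemma sin_mult_dirichlet_kernel:
  "2 * sin (u / 2) * dirichlet_kernel k u = sin ((real k + 1 / 2) * u)"
proof (induction k)
  case 0
  then show ?case by (simp add: dirichlet_kernel_def)
next
  case (Suc k)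
  have "2 * sin (u / 2) * dirichlet_kernel (Suc k) u
      = sin ((real k + 1 / 2) * u) + 2 * sin (u / 2) * cos (real (Suc k) * u)"
    using Suc by (simp add: dirichlet_kernel_def algebra_simps)
  also have "\<dots> = sin (real (Suc k) * u - u / 2) + 2 * sin (u / 2) * cos (real (Suc k) * u)"
    by (simp add: algebra_simps)
  also have "\<dots> = sin (real (Suc k) * u + u / 2)"
    by (simp add: sin_add sin_diff)
  also have "\<dots> = sin ((real (Suc k) + 1 / 2) * u)"
    by (simp add: algebra_simps)
  finally show ?case .
qed

text \<open>A second factor \<open>2 * sin (u / 2)\<close> makes the sum over \<open>k\<close>
  telescope too; this is the source of the decay of order \<open>1 / u^2\<close>.\<close>

lemma sin_mult_sum_dirichlet_kernel:
  assumes "a \<le> b"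
  shows "4 * sin (u / 2) ^ 2 * (\<Sum>k=a..<b. dirichlet_kernel k u) = cos (real a * u) - cos (real b * u)"
  using assms
proof (induction b rule: dec_induct)
  case base
  then show ?case by simp
next
  case (step b)
  have "4 * sin (u / 2) ^ 2 * dirichlet_kernel b u
      = 2 * sin (u / 2) * sin (real b * u + u / 2)"
    using sin_mult_dirichlet_kernel[of u b] by (simp add: power2_eq_square algebra_simps)
  also have "\<dots> = cos (real b * u) - cos ((real b * u + u / 2) + u / 2)"
  proof -
    have "cos (real b * u) = cos ((real b * u + u / 2) - u / 2)" by simp
    then show ?thesis
      unfolding cos_diff cos_add[of "real b * u + u / 2"] by (simp add: algebra_simps)
  qed
  also have "(real b * u + u / 2) + u / 2 = real (Suc b) * u"
    by (simp add: algebra_simps)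
  finally show ?case
    using step by (simp add: algebra_simps)
qed

lemma abs_dirichlet_kernel_le: "\<bar>dirichlet_kernel k u\<bar> \<le> real k + 1"
proof -
  have "\<bar>\<Sum>j=1..k. cos (real j * u)\<bar> \<le> (\<Sum>j=1..k. \<bar>cos (real j * u)\<bar>)"
    by (rule sum_abs)
  also have "\<dots> \<le> (\<Sum>j=1..k. 1)"
    by (intro sum_mono) simp
  finally show ?thesis
    by (simp add: dirichlet_kernel_def)
qed

text \<open>Jordan's inequality with \<open>1 / 4\<close> in place of the sharp
  \<open>1 / pi\<close>. It follows from the bound \<open>v - v^3 / 6\<close> for the sine, because
  \<open>v^2 \<le> 3\<close> on \<open>[0, pi / 2]\<close>.\<close>

lemma abs_sin_half_ge:
  fixes u :: real
  assumes "\<bar>u\<bar> \<le> pi"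
  shows "\<bar>u\<bar> / 4 \<le> \<bar>sin (u / 2)\<bar>"
proof -
  have *: "v / 2 \<le> sin v" if "0 \<le> v" "v \<le> pi / 2" for v :: real
  proof -
    have "\<bar>sin v - (\<Sum>m<3. sin_coeff m * v ^ m)\<bar> \<le> inverse (fact 3) * \<bar>v\<bar> ^ 3"
      by (rule Maclaurin_sin_bound)
    then have "v - v ^ 3 / 6 \<le> sin v"
      using that by (simp add: numeral_3_eq_3 sin_coeff_def fact_numeral abs_if split: if_splits)
    moreover have "v ^ 3 / 6 \<le> v / 2"
    proof -
      have "v \<le> 8 / 5" using that pi_approx by simp
      then have "v * v \<le> 8 / 5 * (8 / 5)"
        using that by (intro mult_mono) auto
      then have "v * (v * v) \<le> v * 3"
        using that by (intro mult_left_mono) auto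
      then show ?thesis by (simp add: power3_eq_cube)
    qed
    ultimately show ?thesis by simp
  qed
  show ?thesis
  proof (cases "u \<ge> 0")
    case True
    then show ?thesis using *[of "u / 2"] assms by simp
  next
    case False
    then show ?thesis using *[of "- u / 2"] assms by simp
  qed
qed

lemma abs_vp_kernel_average:
  assumes "m \<le> n" and "\<And>k. k \<le> n \<Longrightarrow> \<bar>dirichlet_kernel k u\<bar> \<le> K"
  shows "\<bar>vp_kernel n m u\<bar> \<le> K"
proof -
  have "\<bar>\<Sum>k=n-m..n. dirichlet_kernel k u\<bar> \<le> (\<Sum>k=n-m..n. \<bar>dirichlet_kernel k u\<bar>)"
    by (rule sum_abs)
  also have "\<dots> \<le> (\<Sum>k=n-m..n. K)"
    using assms by (intro sum_mono) auto
  also have "\<dots> = (real m + 1) * K"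
    using \<open>m \<le> n\<close> by simp
  finally show ?thesis
    by (simp add: vp_kernel_def abs_mult field_simps)
qed

lemma abs_vp_kernel_le_const:
  assumes "m \<le> n"
  shows "\<bar>vp_kernel n m u\<bar> \<le> real n + 1"
proof (rule abs_vp_kernel_average[OF assms])
  show "\<bar>dirichlet_kernel k u\<bar> \<le> real n + 1" if "k \<le> n" for k
    using abs_dirichlet_kernel_le[of k u] that by simp
qed

lemma abs_vp_kernel_le_inverse:
  assumes "m \<le> n" "u \<noteq> 0" "\<bar>u\<bar> \<le> pi"
  shows "\<bar>vp_kernel n m u\<bar> \<le> 2 / \<bar>u\<bar>"
proof (rule abs_vp_kernel_average[OF \<open>m \<le> n\<close>])
  fix k
  have "\<bar>u\<bar> / 2 * \<bar>dirichlet_kernel k u\<bar> \<le> 2 * \<bar>sin (u / 2)\<bar> * \<bar>dirichlet_kernel k u\<bar>"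
    using abs_sin_half_ge[OF assms(3)] by (intro mult_right_mono) auto
  also have "\<dots> = \<bar>sin ((real k + 1 / 2) * u)\<bar>"
    by (simp flip: sin_mult_dirichlet_kernel add: abs_mult)
  also have "\<dots> \<le> 1" by simp
  finally show "\<bar>dirichlet_kernel k u\<bar> \<le> 2 / \<bar>u\<bar>"
    using assms by (simp add: field_simps)
qed

text \<open>The block of kernels is estimated as a whole: it telescopes to a difference of two
  cosines, so the factor \<open>1 / (m + 1)\<close> of the average survives as a gain.\<close>

lemma abs_vp_kernel_le_inverse_square:
  assumes "m \<le> n" "u \<noteq> 0" "\<bar>u\<bar> \<le> pi"
  shows "\<bar>vp_kernel n m u\<bar> \<le> 8 / ((real m + 1) * u ^ 2)"
proof -
  let ?D = "\<Sum>k=n-m..n. dirichlet_kernel k u"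
  have "(\<bar>u\<bar> / 4) ^ 2 \<le> \<bar>sin (u / 2)\<bar> ^ 2"
    using abs_sin_half_ge[OF assms(3)] by (intro power_mono) auto
  then have "u ^ 2 / 4 \<le> 4 * sin (u / 2) ^ 2"
    by (simp add: power_divide)
  then have "u ^ 2 / 4 * \<bar>?D\<bar> \<le> 4 * sin (u / 2) ^ 2 * \<bar>?D\<bar>"
    by (intro mult_right_mono) auto
  also have "\<dots> = \<bar>4 * sin (u / 2) ^ 2 * ?D\<bar>"
    by (simp add: abs_mult)
  also have "\<dots> = \<bar>cos (real (n - m) * u) - cos (real (Suc n) * u)\<bar>"
    using sin_mult_sum_dirichlet_kernel[of "n - m" "Suc n" u] \<open>m \<le> n\<close>
    by (simp add: atLeastLessThanSuc_atLeastAtMost)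
  also have "\<dots> \<le> 2"
    using abs_cos_le_one[of "real (n - m) * u"] abs_cos_le_one[of "real (Suc n) * u"] by linarith
  finally have "\<bar>?D\<bar> \<le> 8 / u ^ 2"
    using assms by (simp add: field_simps)
  then have "\<bar>?D\<bar> / (real m + 1) \<le> 8 / u ^ 2 / (real m + 1)"
    by (intro divide_right_mono) auto
  then show ?thesis
    by (simp add: vp_kernel_def abs_mult mult.commute)
qed

lemma continuous_on_vp_kernel [continuous_intros]: "continuous_on S (vp_kernel n m)"
  unfolding vp_kernel_def dirichlet_kernel_def by (intro continuous_intros)

section \<open>Integral representation of the partial sums and of the error\<close>

lemma absolutely_integrable_mult_continuous:
  fixes f g :: "real \<Rightarrow> real"
  assumes "f absolutely_integrable_on {a..b}" "continuous_on {a..b} g"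
  shows "(\<lambda>x. f x * g x) absolutely_integrable_on {a..b}"
proof -
  have "(\<lambda>x. g x * f x) absolutely_integrable_on {a..b}"
    using assms
    by (intro absolutely_integrable_bounded_measurable_product_real continuous_imp_measurable_on_sets_lebesgue
        compact_imp_bounded compact_continuous_image) auto
  then show ?thesis by (simp add: mult.commute)
qed

lemma has_integral_dirichlet_kernel: "(dirichlet_kernel k has_integral pi) {-pi..pi}"
proof -
  have "((\<lambda>u. cos (real j * u)) has_integral 0) {-pi..pi}" if "j \<in> {1..k}" for j
    using has_integral_cos_nx[of "int j"] that by (simp split: if_splits)
  then have "((\<lambda>u. \<Sum>j=1..k. cos (real j * u)) has_integral (\<Sum>j=1..k. 0)) {-pi..pi}"
    by (intro has_integral_sum) auto
  moreover have "((\<lambda>u. 1 / 2) has_integral pi) {-pi..pi}"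
    using has_integral_const_real[of "1 / 2 :: real" "-pi" pi] by simp
  ultimately have "((\<lambda>u. 1 / 2 + (\<Sum>j=1..k. cos (real j * u))) has_integral pi + (\<Sum>j=1..k. 0)) {-pi..pi}"
    by (intro has_integral_add)
  then show ?thesis
    by (simp add: dirichlet_kernel_def[abs_def])
qed

lemma has_integral_vp_kernel:
  assumes "m \<le> n"
  shows "(vp_kernel n m has_integral pi) {-pi..pi}"
proof -
  have "((\<lambda>u. 1 / (real m + 1) * (\<Sum>k=n-m..n. dirichlet_kernel k u)) has_integral
      1 / (real m + 1) * (\<Sum>k=n-m..n. pi)) {-pi..pi}"
    by (intro has_integral_mult_right has_integral_sum has_integral_dirichlet_kernel) auto
  then show ?thesis
    using assms by (simp add: vp_kernel_def[abs_def] add.commute)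
qed

text \<open>Expanding \<open>cos (j * (t - x))\<close> turns the partial sum into an integral
  against the kernel at \<open>t - x\<close>; periodicity then allows \<open>t = x + u\<close> with
  \<open>u\<close> again in \<open>{-pi..pi}\<close>.\<close>

lemma has_integral_fourier_sum:
  assumes per: "\<And>x. f (x + 2 * pi) = f x" and f: "f absolutely_integrable_on {-pi..pi}"
  shows "((\<lambda>u. f (x + u) * dirichlet_kernel k u) has_integral pi * fourier_sum k f x) {-pi..pi}"
proof -
  let ?I = "{-pi..pi}"
  have int: "(\<lambda>t. f t * g t) integrable_on ?I" if "continuous_on ?I g" for g
    using absolutely_integrable_mult_continuous[OF f that] by (simp add: absolutely_integrable_on_def)
  have L: "(LINT t|lebesgue_on ?I. f t * g t) = integral ?I (\<lambda>t. f t * g t)"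
    if "continuous_on ?I g" for g
    by (intro lebesgue_integral_eq_integral absolutely_integrable_imp_integrable
        absolutely_integrable_mult_continuous f that) auto
  have c: "((\<lambda>t. f t * cos (real j * t)) has_integral pi * fourier_cos_coeff f j) ?I" for j
  proof -
    have "continuous_on ?I (\<lambda>t. cos (real j * t))"
      by (intro continuous_intros)
    from integrable_integral[OF int[OF this]] L[OF this] show ?thesis
      by (simp add: fourier_cos_coeff_def)
  qed
  have s: "((\<lambda>t. f t * sin (real j * t)) has_integral pi * fourier_sin_coeff f j) ?I" for j
  proof -
    have "continuous_on ?I (\<lambda>t. sin (real j * t))"
      by (intro continuous_intros)
    from integrable_integral[OF int[OF this]] L[OF this] show ?thesis
      by (simp add: fourier_sin_coeff_def)
  qed
  \<comment> \<open>The constant term is written with \<open>cos (real 0 * t)\<close> so that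
    \<open>c\<close> covers it as well.\<close>
  have "((\<lambda>t. f t * cos (real 0 * t) * (1 / 2) + (\<Sum>j=1..k. f t * cos (real j * t) * cos (real j * x)
         + f t * sin (real j * t) * sin (real j * x))) has_integral
      pi * fourier_cos_coeff f 0 * (1 / 2) + (\<Sum>j=1..k. pi * fourier_cos_coeff f j * cos (real j * x)
         + pi * fourier_sin_coeff f j * sin (real j * x))) ?I"
    by (intro has_integral_add has_integral_sum has_integral_mult_left c s) auto
  moreover have "f t * cos (real 0 * t) * (1 / 2) + (\<Sum>j=1..k. f t * cos (real j * t) * cos (real j * x)
         + f t * sin (real j * t) * sin (real j * x)) = f t * dirichlet_kernel k (t - x)" for t
    by (simp add: dirichlet_kernel_def right_diff_distrib cos_diff sum_distrib_left algebra_simps)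
  moreover have "pi * fourier_cos_coeff f 0 * (1 / 2) + (\<Sum>j=1..k. pi * fourier_cos_coeff f j * cos (real j * x)
         + pi * fourier_sin_coeff f j * sin (real j * x)) = pi * fourier_sum k f x"
    by (simp add: fourier_sum_def sum_distrib_left algebra_simps)
  ultimately have *: "((\<lambda>t. f t * dirichlet_kernel k (t - x)) has_integral pi * fourier_sum k f x) ?I"
    by simp
  have cont: "continuous_on S (\<lambda>t. dirichlet_kernel k (t - x))" for S x
    unfolding dirichlet_kernel_def by (intro continuous_intros)
  have "dirichlet_kernel k (t + 2 * pi - x) = dirichlet_kernel k (t - x)" for t
  proof -
    have "cos (real j * (t + 2 * pi - x)) = cos (real j * (t - x))" for j
      using cos.plus_of_nat[of "real j * (t - x)" j] by (simp add: algebra_simps)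
    then show ?thesis by (simp add: dirichlet_kernel_def)
  qed
  then have "integral ?I (\<lambda>u. f (x + u) * dirichlet_kernel k (x + u - x)) = integral ?I (\<lambda>t. f t * dirichlet_kernel k (t - x))"
    by (intro integral_periodic_shift absolutely_integrable_mult_continuous f cont) (simp add: per)
  moreover have "(\<lambda>u. f (x + u) * dirichlet_kernel k u) absolutely_integrable_on ?I"
    using absolutely_integrable_shift_real_ivl[OF absolutely_integrable_periodic[OF assms, of "x - pi" "x + pi"], of x]
      cont[of _ 0]
    by (intro absolutely_integrable_mult_continuous) (simp_all add: add.commute)
  ultimately show ?thesis
    using integral_unique[OF *] by (simp add: has_integral_iff absolutely_integrable_on_def)
qed

text \<open>As the kernel has integral \<open>pi\<close>, the number \<open>pi * f x\<close> can be
  moved under the integral.\<close>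

lemma has_integral_vallee_poussin_mean_diff:
  assumes "\<And>x. f (x + 2 * pi) = f x" and "f absolutely_integrable_on {-pi..pi}" and "m \<le> n"
  shows "((\<lambda>u. (f (x + u) - f x) * vp_kernel n m u) has_integral
    pi * (vallee_poussin_mean n m f x - f x)) {-pi..pi}"
proof -
  have "((\<lambda>u. 1 / (real m + 1) * (\<Sum>k=n-m..n. f (x + u) * dirichlet_kernel k u) - f x * vp_kernel n m u)
      has_integral 1 / (real m + 1) * (\<Sum>k=n-m..n. pi * fourier_sum k f x) - f x * pi) {-pi..pi}"
    by (intro has_integral_diff has_integral_mult_right has_integral_sum has_integral_fourier_sum
        has_integral_vp_kernel assms) auto
  moreover have "1 / (real m + 1) * (\<Sum>k=n-m..n. f (x + u) * dirichlet_kernel k u) - f x * vp_kernel n m u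
      = (f (x + u) - f x) * vp_kernel n m u" for u
    by (simp add: vp_kernel_def left_diff_distrib sum_distrib_left diff_divide_distrib sum_subtractf)
  moreover have "1 / (real m + 1) * (\<Sum>k=n-m..n. pi * fourier_sum k f x) - f x * pi
      = pi * (vallee_poussin_mean n m f x - f x)"
    by (simp add: vallee_poussin_mean_def right_diff_distrib sum_distrib_left)
  ultimately show ?thesis by simp
qed

section \<open>Dyadic domination of the kernel\<close>

text \<open>Splitting off the first term, which is at most \<open>1\<close>, leaves a sum of the
  same form with \<open>A\<close> halved. After \<open>L\<close> halvings \<open>A \<le> 1\<close>,
  and a geometric series bounded by \<open>2\<close> remains.\<close>

lemma sum_min_one_geometric_le:
  fixes A :: real
  assumes "A \<le> 2 ^ L"
  shows "(\<Sum>j<K. min 1 (A / 2 ^ j)) \<le> real L + 2"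
  using assms
proof (induction L arbitrary: A K)
  case 0
  have "(\<Sum>j<K. min 1 (A / 2 ^ j)) \<le> (\<Sum>j<K. (1 / 2) ^ j)"
    using 0 by (intro sum_mono min.coboundedI2) (simp add: power_one_over divide_right_mono)
  also have "\<dots> \<le> 2"
    by (simp add: sum_gp_strict)
  finally show ?case by simp
next
  case (Suc L)
  show ?case
  proof (cases K)
    case 0
    then show ?thesis by simp
  next
    case (Suc K')
    have "(\<Sum>j<K. min 1 (A / 2 ^ j)) = min 1 A + (\<Sum>j<K'. min 1 (A / 2 / 2 ^ j))"
      unfolding Suc sum.lessThan_Suc_shift by simp
    also have "\<dots> \<le> 1 + (real L + 2)"
      using Suc.prems by (intro add_mono Suc.IH) auto
    finally show ?thesis by simp
  qed
qed

text \<open>With \<open>L\<close> the rounded-up binary logarithm, the bound is at most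
  \<open>log 2 A + 3\<close>, and \<open>ln 2 \<ge> 2 / 3\<close> gives
  \<open>log 2 A \<le> 3 / 2 * ln A\<close>.\<close>

lemma sum_min_one_geometric_le_ln:
  fixes A :: real
  assumes "1 \<le> A"
  shows "(\<Sum>j<K. min 1 (A / 2 ^ j)) \<le> 3 * (1 + ln A)"
proof -
  define L where "L = nat \<lceil>log 2 A\<rceil>"
  have log: "0 \<le> log 2 A" using assms by simp
  have "A = 2 powr (log 2 A)" using assms by simp
  also have "\<dots> \<le> 2 powr real L"
    using log by (intro powr_mono) (simp_all add: L_def)
  also have "\<dots> = 2 ^ L" by (simp add: powr_realpow)
  finally have "(\<Sum>j<K. min 1 (A / 2 ^ j)) \<le> real L + 2"
    by (rule sum_min_one_geometric_le)
  moreover have "real L \<le> log 2 A + 1"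
    using log by (simp add: L_def)
  moreover have "log 2 A \<le> ln A / (2 / 3)"
    unfolding log_def using ln2_ge_two_thirds assms by (intro divide_left_mono) auto
  ultimately show ?thesis
    using ln_ge_zero[OF assms] by simp
qed

text \<open>A single summand suffices for small \<open>u\<close>: that of the least \<open>j\<close>
  with \<open>\<bar>u\<bar> \<le> 2 ^ j / N\<close>. For larger \<open>u\<close> the last term
  bounds the kernel. The constant \<open>32\<close> is \<open>8 * 2^2\<close>, the price of
  replacing \<open>u\<close> by half of \<open>2 ^ j / N\<close> or of \<open>\<eta>\<close> in the
  inverse-square bound.\<close>

lemma abs_vp_kernel_le_dyadic:
  fixes n m :: nat and \<eta> u :: real
  defines "N \<equiv> real n + 1" and "M \<equiv> real m + 1"
  assumes "m \<le> n" "\<bar>u\<bar> \<le> pi" "0 < \<eta>" "1 \<le> \<eta> * N" "finite S" and S: "{j. 2 ^ j \<le> \<eta> * N} \<subseteq> S"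
  shows "\<bar>vp_kernel n m u\<bar> \<le>
    (\<Sum>j\<in>S. if \<bar>u\<bar> \<le> 2 ^ j / N then 32 * (N / 2 ^ j) * min 1 (N / M / 2 ^ j) else 0) + 32 / (M * \<eta>\<^sup>2)"
    (is "_ \<le> (\<Sum>j\<in>S. ?c j) + ?E")
proof -
  have pos: "N > 0" "M > 0" "M \<le> N" using \<open>m \<le> n\<close> by (auto simp: N_def M_def)
  have nonneg: "0 \<le> ?c j" for j using pos by simp
  have E: "0 \<le> ?E" using pos by simp
  \<comment> \<open>The threshold is \<open>\<eta> / 2\<close> because a least \<open>j > 0\<close>
    has \<open>2 ^ j / N < 2 * \<bar>u\<bar>\<close>, which must not exceed \<open>\<eta>\<close>
    for \<open>j\<close> to lie in \<open>S\<close>.\<close>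
  consider "\<eta> / 2 < \<bar>u\<bar>" | "\<bar>u\<bar> \<le> \<eta> / 2" by linarith
  then show ?thesis
  proof cases
    case 1
    have "(\<eta> / 2)\<^sup>2 \<le> \<bar>u\<bar>\<^sup>2" using 1 \<open>0 < \<eta>\<close> by (intro power_mono) auto
    then have "8 / (M * u\<^sup>2) \<le> 8 / (M * (\<eta> / 2)\<^sup>2)"
      using pos 1 \<open>0 < \<eta>\<close> by (intro divide_left_mono mult_left_mono mult_pos_pos) auto
    moreover have "\<bar>vp_kernel n m u\<bar> \<le> 8 / (M * u\<^sup>2)"
      unfolding M_def using 1 assms by (intro abs_vp_kernel_le_inverse_square) auto
    moreover have "8 / (M * (\<eta> / 2)\<^sup>2) = ?E"
      by (simp add: power_divide)
    moreover have "0 \<le> (\<Sum>j\<in>S. ?c j)"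
      using nonneg by (intro sum_nonneg)
    ultimately show ?thesis by linarith
  next
    case 2
    have "\<exists>j. \<bar>u\<bar> \<le> 2 ^ j / N"
    proof -
      obtain j where "\<bar>u\<bar> * N < 2 ^ j"
        using real_arch_pow[of 2 "\<bar>u\<bar> * N"] by auto
      then show ?thesis using pos by (intro exI[of _ j]) (simp add: field_simps)
    qed
    then obtain j where j: "\<bar>u\<bar> \<le> 2 ^ j / N" and least: "\<And>i. i < j \<Longrightarrow> 2 ^ i / N < \<bar>u\<bar>"
      using exists_least_iff[of "\<lambda>j. \<bar>u\<bar> \<le> 2 ^ j / N"] by (metis not_le)
    have "2 ^ j \<le> \<eta> * N \<and> \<bar>vp_kernel n m u\<bar> \<le> 32 * (N / 2 ^ j) * min 1 (N / M / 2 ^ j)"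
    proof (cases j)
      \<comment> \<open>There is no smaller power to bound \<open>\<bar>u\<bar>\<close> from below,
        so the trivial bound \<open>N\<close> is used, and \<open>1 \<le> \<eta> * N\<close> puts
        \<open>0\<close> into \<open>S\<close>.\<close>
      case 0
      have "\<bar>vp_kernel n m u\<bar> \<le> N"
        unfolding N_def using assms by (intro abs_vp_kernel_le_const)
      moreover have "min 1 (N / M) = 1" using pos by simp
      ultimately show ?thesis using 0 \<open>1 \<le> \<eta> * N\<close> pos by simp
    next
      case (Suc i)
      define h where "h = 2 ^ j / N"
      have h: "0 < h" "h / 2 < \<bar>u\<bar>" using least[of i] Suc pos by (simp_all add: h_def)
      then have "u \<noteq> 0" by auto
      have "h < \<eta>" using h 2 by simp
      then have "2 ^ j \<le> \<eta> * N" using pos by (simp add: h_def field_simps)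
      moreover have "\<bar>vp_kernel n m u\<bar> \<le> 32 * (N / 2 ^ j)"
      proof -
        have "\<bar>vp_kernel n m u\<bar> \<le> 2 / \<bar>u\<bar>"
          using \<open>u \<noteq> 0\<close> assms by (intro abs_vp_kernel_le_inverse) auto
        also have "\<dots> \<le> 2 / (h / 2)"
          using h by (intro divide_left_mono mult_pos_pos) auto
        also have "\<dots> \<le> 32 * (N / 2 ^ j)" using pos by (simp add: h_def divide_right_mono)
        finally show ?thesis .
      qed
      moreover have "\<bar>vp_kernel n m u\<bar> \<le> 32 * (N / 2 ^ j) * (N / M / 2 ^ j)"
      proof -
        have "(h / 2)\<^sup>2 \<le> \<bar>u\<bar>\<^sup>2"
          using h by (intro power_mono) auto
        then have "8 / (M * u\<^sup>2) \<le> 8 / (M * (h / 2)\<^sup>2)"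
          using pos h \<open>u \<noteq> 0\<close> by (intro divide_left_mono mult_left_mono mult_pos_pos) auto
        moreover have "\<bar>vp_kernel n m u\<bar> \<le> 8 / (M * u\<^sup>2)"
          unfolding M_def using \<open>u \<noteq> 0\<close> assms by (intro abs_vp_kernel_le_inverse_square) auto
        moreover have "8 / (M * (h / 2)\<^sup>2) = 32 * (N / 2 ^ j) * (N / M / 2 ^ j)"
          using pos by (simp add: h_def field_simps power2_eq_square)
        ultimately show ?thesis by linarith
      qed
      ultimately show ?thesis by (auto simp only: min_def mult.right_neutral split: if_splits)
    qed
    then have "\<bar>vp_kernel n m u\<bar> \<le> ?c j" "j \<in> S"
      using j S by auto
    moreover have "?c j \<le> (\<Sum>j\<in>S. ?c j)"
      using nonneg \<open>finite S\<close> \<open>j \<in> S\<close> by (intro member_le_sum) auto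
    ultimately show ?thesis using E by linarith
  qed
qed

text \<open>On the interval of radius \<open>h = 2 ^ j / N\<close> the integral of \<open>g\<close>
  is at most \<open>\<delta> * h\<close>, which cancels the factor \<open>N / 2 ^ j\<close> of the
  dyadic coefficient. The sum of the remaining minima costs a factor \<open>3\<close>, whence
  \<open>96 = 32 * 3\<close>.\<close>

lemma integral_mult_abs_vp_kernel_le:
  fixes g :: "real \<Rightarrow> real" and n m :: nat and \<eta> \<delta> :: real
  defines "N \<equiv> real n + 1" and "M \<equiv> real m + 1"
  assumes g: "g absolutely_integrable_on {-pi..pi}" "\<And>u. 0 \<le> g u"
    and "m \<le> n" "0 < \<eta>" "\<eta> \<le> pi" "1 \<le> \<eta> * N" "0 \<le> \<delta>"
    and small: "\<And>h. 0 < h \<Longrightarrow> h \<le> \<eta> \<Longrightarrow> integral {-h..h} g \<le> \<delta> * h"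
  shows "integral {-pi..pi} (\<lambda>u. g u * \<bar>vp_kernel n m u\<bar>) \<le>
    96 * \<delta> * (1 + ln (N / M)) + 32 / (M * \<eta>\<^sup>2) * integral {-pi..pi} g"
proof -
  define S where "S = {j :: nat. 2 ^ j \<le> \<eta> * N}"
  define c where "c j = 32 * (N / 2 ^ j) * min 1 (N / M / 2 ^ j)" for j :: nat
  define E where "E = 32 / (M * \<eta>\<^sup>2)"
  have pos: "N > 0" "M > 0" "M \<le> N" using \<open>m \<le> n\<close> by (auto simp: N_def M_def)
  obtain K :: nat where K: "\<eta> * N < real K"
    using reals_Archimedean2 by blast
  have SK: "S \<subseteq> {..<K}"
  proof
    fix j assume "j \<in> S"
    have "real j < 2 ^ j" by (rule of_nat_less_two_power)
    also have "\<dots> \<le> \<eta> * N" using \<open>j \<in> S\<close> by (simp add: S_def)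
    also have "\<dots> < real K" by (rule K)
    finally show "j \<in> {..<K}" by (simp only: of_nat_less_iff lessThan_iff)
  qed
  then have fin: "finite S" using finite_subset by blast
  have g_int: "g integrable_on {-pi..pi}"
    using g(1) by (simp add: absolutely_integrable_on_def)
  have lhs: "(\<lambda>u. g u * \<bar>vp_kernel n m u\<bar>) integrable_on {-pi..pi}"
  proof -
    have "(\<lambda>u. g u * \<bar>vp_kernel n m u\<bar>) absolutely_integrable_on {-pi..pi}"
      by (intro absolutely_integrable_mult_continuous g continuous_intros)
    then show ?thesis by (simp add: absolutely_integrable_on_def)
  qed
  have piece: "((\<lambda>u. c j * (if u \<in> {-(2 ^ j / N)..2 ^ j / N} then g u else 0)) has_integral
      c j * integral {-(2 ^ j / N)..2 ^ j / N} g) {-pi..pi}" if "j \<in> S" for j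
  proof -
    have "2 ^ j / N \<le> \<eta>" using that pos by (simp add: S_def field_simps)
    then have sub: "{-(2 ^ j / N)..2 ^ j / N} \<subseteq> {-pi..pi}"
      using \<open>\<eta> \<le> pi\<close> by (simp add: atLeastatMost_subset_iff)
    have "g integrable_on {-(2 ^ j / N)..2 ^ j / N}"
      using integrable_on_subinterval[OF g_int sub] .
    then show ?thesis
      by (intro has_integral_mult_right) (simp only: has_integral_restrict[OF sub] integrable_integral)
  qed
  have rhs: "((\<lambda>u. (\<Sum>j\<in>S. c j * (if u \<in> {-(2 ^ j / N)..2 ^ j / N} then g u else 0)) + E * g u) has_integral
      (\<Sum>j\<in>S. c j * integral {-(2 ^ j / N)..2 ^ j / N} g) + E * integral {-pi..pi} g) {-pi..pi}"
    by (intro has_integral_add has_integral_sum has_integral_mult_right integrable_integral g_int piece fin)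
  have "integral {-pi..pi} (\<lambda>u. g u * \<bar>vp_kernel n m u\<bar>) \<le>
      (\<Sum>j\<in>S. c j * integral {-(2 ^ j / N)..2 ^ j / N} g) + E * integral {-pi..pi} g"
  proof (rule has_integral_le[OF integrable_integral[OF lhs] rhs])
    fix u assume u: "u \<in> {-pi..pi}"
    have "\<bar>vp_kernel n m u\<bar> \<le> (\<Sum>j\<in>S. if \<bar>u\<bar> \<le> 2 ^ j / N then c j else 0) + E"
      unfolding c_def E_def N_def M_def
      by (rule abs_vp_kernel_le_dyadic) (use u assms fin in \<open>auto simp: S_def N_def\<close>)
    then have "g u * \<bar>vp_kernel n m u\<bar> \<le> g u * ((\<Sum>j\<in>S. if \<bar>u\<bar> \<le> 2 ^ j / N then c j else 0) + E)"
      using g(2) by (intro mult_left_mono)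
    also have "\<dots> = (\<Sum>j\<in>S. c j * (if u \<in> {-(2 ^ j / N)..2 ^ j / N} then g u else 0)) + E * g u"
      unfolding distrib_left sum_distrib_left
      by (intro arg_cong2[of _ _ _ _ "(+)"] sum.cong) (auto simp: abs_le_iff)
    finally show "g u * \<bar>vp_kernel n m u\<bar> \<le> \<dots>" .
  qed
  also have "(\<Sum>j\<in>S. c j * integral {-(2 ^ j / N)..2 ^ j / N} g) \<le> (\<Sum>j\<in>S. 32 * \<delta> * min 1 (N / M / 2 ^ j))"
  proof (rule sum_mono)
    fix j assume "j \<in> S"
    have "c j * integral {-(2 ^ j / N)..2 ^ j / N} g \<le> c j * (\<delta> * (2 ^ j / N))"
      using \<open>j \<in> S\<close> pos by (intro mult_left_mono small) (auto simp: S_def c_def field_simps)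
    also have "\<dots> = 32 * \<delta> * min 1 (N / M / 2 ^ j)"
      using pos by (simp add: c_def)
    finally show "c j * integral {-(2 ^ j / N)..2 ^ j / N} g \<le> \<dots>" .
  qed
  \<comment> \<open>Filling \<open>S\<close> up to an initial segment is harmless: the terms are
    nonnegative and the logarithmic bound is independent of \<open>K\<close>.\<close>
  also have "\<dots> \<le> (\<Sum>j<K. 32 * \<delta> * min 1 (N / M / 2 ^ j))"
    using SK pos \<open>0 \<le> \<delta>\<close> by (intro sum_mono2) auto
  also have "\<dots> = 32 * \<delta> * (\<Sum>j<K. min 1 (N / M / 2 ^ j))"
    by (simp add: sum_distrib_left)
  also have "\<dots> \<le> 32 * \<delta> * (3 * (1 + ln (N / M)))"
    using pos \<open>0 \<le> \<delta>\<close> by (intro mult_left_mono sum_min_one_geometric_le_ln) auto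
  finally show ?thesis by (simp add: E_def distrib_left)
qed

section \<open>Estimate of the error, uniform in \<open>m\<close>, at a Lebesgue point of order
  1\<close>

text \<open>The weight \<open>1 + ln (N / M)\<close> absorbs the term \<open>1 / M\<close> uniformly in \<open>M\<close>, because \<open>M * (1 + ln (N / M))\<close>
  is increasing in \<open>M\<close> on \<open>[1, N]\<close>.\<close>

lemma one_plus_ln_le:
  fixes M N :: real
  assumes "1 \<le> M" "M \<le> N"
  shows "1 + ln N \<le> M * (1 + ln (N / M))"
proof -
  have "ln N = ln (N / M) + ln M" using assms by (simp add: ln_div)
  moreover have "ln M \<le> M - 1" using assms by (intro ln_le_minus_one) simp
  moreover have "0 \<le> (M - 1) * ln (N / M)" using assms by simp
  ultimately show ?thesis by (simp add: algebra_simps)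
qed

text \<open>The near and the far part of the integral each contribute at most \<open>e\<close> times
  the weight; \<open>n0\<close> has to serve all \<open>m \<le> n\<close> at once.\<close>

lemma vallee_poussin_mean_small:
  assumes per: "\<And>x. f (x + 2 * pi) = f x" and f: "f absolutely_integrable_on {-pi..pi}"
    and point: "\<And>\<delta>. 0 < \<delta> \<Longrightarrow>
      \<exists>\<eta>>0. \<forall>h. 0 < h \<and> h \<le> \<eta> \<longrightarrow> integral {-h..h} (\<lambda>t. \<bar>f (x + t) - f x\<bar>) \<le> \<delta> * h"
    and "0 < e"
  shows "\<exists>n0. \<forall>n\<ge>n0. \<forall>m\<le>n.
    \<bar>vallee_poussin_mean n m f x - f x\<bar> \<le> e * (1 + ln ((real n + 1) / (real m + 1)))"
proof -
  let ?I = "{-pi..pi}"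
  define g where "g = (\<lambda>t. \<bar>f (x + t) - f x\<bar>)"
  have "(\<lambda>t. f (x + t)) absolutely_integrable_on ?I"
    using absolutely_integrable_shift_real_ivl[OF absolutely_integrable_periodic[OF per f, of "x - pi" "x + pi"], of x]
    by (simp add: add.commute)
  then have diff: "(\<lambda>t. f (x + t) - f x) absolutely_integrable_on ?I"
    by (rule set_integral_diff) (intro absolutely_integrable_continuous_real continuous_intros)
  then have g: "g absolutely_integrable_on ?I"
    unfolding g_def by (intro set_integrable_abs)
  define B where "B = integral ?I g"
  have "0 \<le> B"
    unfolding B_def using g by (intro integral_nonneg) (auto simp: absolutely_integrable_on_def g_def)
  obtain \<eta>' where \<eta>': "\<eta>' > 0" "\<And>h. 0 < h \<Longrightarrow> h \<le> \<eta>' \<Longrightarrow> integral {-h..h} g \<le> e / 96 * h"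
    using point[of "e / 96"] \<open>0 < e\<close> unfolding g_def by auto
  define \<eta> where "\<eta> = min \<eta>' pi"
  have \<eta>: "0 < \<eta>" "\<eta> \<le> pi" using \<eta>' by (auto simp: \<eta>_def)
  have "filterlim (\<lambda>n. 1 + real n) at_top sequentially"
    by (rule filterlim_tendsto_add_at_top[OF tendsto_const filterlim_real_sequentially])
  then have "filterlim (\<lambda>n. ln (real n + 1)) at_top sequentially"
    by (intro filterlim_compose[OF ln_at_top]) (simp add: add.commute)
  \<comment> \<open>This makes the far part small even for \<open>m = 0\<close>; the next condition
    yields \<open>1 \<le> \<eta> * N\<close>.\<close>
  then have "\<forall>\<^sub>F n in sequentially. 32 * B / (\<eta>\<^sup>2 * e) \<le> ln (real n + 1)"
    by (simp add: filterlim_at_top)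
  moreover have "\<forall>\<^sub>F n in sequentially. 1 / \<eta> \<le> real n"
    using filterlim_real_sequentially by (simp add: filterlim_at_top)
  ultimately have "\<forall>\<^sub>F n in sequentially. 32 * B / (\<eta>\<^sup>2 * e) \<le> ln (real n + 1) \<and> 1 / \<eta> \<le> real n"
    by (rule eventually_conj)
  then obtain n0 where n0: "\<And>n. n \<ge> n0 \<Longrightarrow> 32 * B / (\<eta>\<^sup>2 * e) \<le> ln (real n + 1) \<and> 1 / \<eta> \<le> real n"
    unfolding eventually_sequentially by blast
  show ?thesis
  proof (intro exI[of _ n0] allI impI)
    fix n m assume "n0 \<le> n" "m \<le> n"
    define N M where "N = real n + 1" and "M = real m + 1"
    have NM: "1 \<le> M" "M \<le> N" using \<open>m \<le> n\<close> by (auto simp: N_def M_def)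
    have "32 * B / (\<eta>\<^sup>2 * e) \<le> ln N" using n0 \<open>n0 \<le> n\<close> by (simp add: N_def)
    then have B: "32 / \<eta>\<^sup>2 * B \<le> e * ln N"
      using \<eta> \<open>0 < e\<close> by (simp add: field_simps)
    have "1 \<le> \<eta> * N"
      using n0[OF \<open>n0 \<le> n\<close>] \<eta> by (simp add: N_def field_simps)
    then have "integral ?I (\<lambda>u. g u * \<bar>vp_kernel n m u\<bar>) \<le> 96 * (e / 96) * (1 + ln (N / M)) + 32 / (M * \<eta>\<^sup>2) * B"
      unfolding B_def N_def M_def using \<eta> \<eta>'(2) \<open>m \<le> n\<close> g \<open>0 < e\<close>
      by (intro integral_mult_abs_vp_kernel_le) (auto simp: g_def \<eta>_def)
    also have "32 / (M * \<eta>\<^sup>2) * B \<le> e * (1 + ln (N / M))"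
    proof -
      have "32 / (M * \<eta>\<^sup>2) * B = 32 / \<eta>\<^sup>2 * B / M" by simp
      also have "\<dots> \<le> e * (1 + ln N) / M"
        using B \<open>0 < e\<close> NM by (intro divide_right_mono) (auto simp: distrib_left)
      also have "\<dots> \<le> e * (M * (1 + ln (N / M))) / M"
        using NM \<open>0 < e\<close> by (intro divide_right_mono mult_left_mono one_plus_ln_le) auto
      also have "\<dots> = e * (1 + ln (N / M))" using NM by simp
      finally show ?thesis .
    qed
    finally have *: "integral ?I (\<lambda>u. g u * \<bar>vp_kernel n m u\<bar>) \<le> 2 * (e * (1 + ln (N / M)))" by simp
    have hi: "((\<lambda>u. (f (x + u) - f x) * vp_kernel n m u) has_integral pi * (vallee_poussin_mean n m f x - f x)) ?I"
      using per f \<open>m \<le> n\<close> by (intro has_integral_vallee_poussin_mean_diff)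
    have "(\<lambda>u. g u * \<bar>vp_kernel n m u\<bar>) absolutely_integrable_on ?I"
      by (intro absolutely_integrable_mult_continuous g continuous_intros)
    then have "norm (integral ?I (\<lambda>u. (f (x + u) - f x) * vp_kernel n m u)) \<le> integral ?I (\<lambda>u. g u * \<bar>vp_kernel n m u\<bar>)"
      using hi by (intro integral_norm_bound_integral) (auto simp: has_integral_iff absolutely_integrable_on_def g_def abs_mult)
    then have "pi * \<bar>vallee_poussin_mean n m f x - f x\<bar> \<le> 2 * (e * (1 + ln (N / M)))"
      using * hi by (simp add: has_integral_iff abs_mult)
    \<comment> \<open>The factor \<open>2\<close> from the two parts is absorbed by
      \<open>pi\<close>.\<close>
    also have "\<dots> \<le> pi * (e * (1 + ln (N / M)))"
      using pi_ge_two NM \<open>0 < e\<close> by (intro mult_right_mono) (auto intro!: mult_nonneg_nonneg add_nonneg_nonneg)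
    finally show "\<bar>vallee_poussin_mean n m f x - f x\<bar> \<le> e * (1 + ln ((real n + 1) / (real m + 1)))"
      by (simp add: N_def M_def)
  qed
qed

section \<open>From \<open>X^p\<close>-points to Lebesgue points of order 1\<close>

lemma integral_small_at_continuity_point:
  fixes f :: "real \<Rightarrow> real"
  assumes "continuous_on UNIV f" "0 < \<delta>"
  shows "\<exists>\<eta>>0. \<forall>h. 0 < h \<and> h \<le> \<eta> \<longrightarrow> integral {-h..h} (\<lambda>t. \<bar>f (x + t) - f x\<bar>) \<le> \<delta> * h"
proof -
  have "isCont f x" using assms(1) by (simp add: continuous_on_eq_continuous_at)
  then obtain s where s: "s > 0" "\<And>y. \<bar>y - x\<bar> < s \<Longrightarrow> \<bar>f y - f x\<bar> < \<delta> / 2"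
    using \<open>0 < \<delta>\<close> unfolding continuous_at_eps_delta by (metis half_gt_zero dist_real_def)
  have "integral {-h..h} (\<lambda>t. \<bar>f (x + t) - f x\<bar>) \<le> \<delta> * h" if "0 < h" "h \<le> s / 2" for h
  proof -
    have "integral {-h..h} (\<lambda>t. \<bar>f (x + t) - f x\<bar>) \<le> integral {-h..h} (\<lambda>t. \<delta> / 2)"
    proof (rule integral_le)
      show "(\<lambda>t. \<bar>f (x + t) - f x\<bar>) integrable_on {-h..h}"
        by (intro integrable_continuous_real continuous_intros continuous_on_compose2[OF assms(1)]) auto
      fix t assume "t \<in> {-h..h}"
      then have "\<bar>t\<bar> < s" using that s(1) unfolding atLeastAtMost_iff by linarith
      then show "\<bar>f (x + t) - f x\<bar> \<le> \<delta> / 2"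
        using s(2)[of "x + t"] by simp
    qed auto
    then show ?thesis using that by (simp add: mult.commute)
  qed
  \<comment> \<open>Halving \<open>s\<close> turns the strict neighbourhood condition into one valid
    for all \<open>h \<le> \<eta>\<close>.\<close>
  then show ?thesis using s(1) by (intro exI[of _ "s / 2"]) auto
qed

text \<open>A crude bound through \<open>2 * max \<bar>a\<bar> \<bar>b\<bar>\<close>; it serves to
  make the \<open>q\<close>-th power of \<open>\<bar>f (x + t) - f x\<bar>\<close>
  integrable.\<close>

lemma abs_diff_powr_le:
  fixes a b q :: real
  assumes "0 \<le> q"
  shows "\<bar>a - b\<bar> powr q \<le> 2 powr q * (\<bar>a\<bar> powr q + \<bar>b\<bar> powr q)"
proof -
  have "\<bar>a - b\<bar> powr q \<le> (2 * max \<bar>a\<bar> \<bar>b\<bar>) powr q"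
    using assms by (intro powr_mono2) auto
  also have "\<dots> = 2 powr q * (max \<bar>a\<bar> \<bar>b\<bar> powr q)"
    by (simp add: powr_mult)
  also have "\<dots> \<le> 2 powr q * (\<bar>a\<bar> powr q + \<bar>b\<bar> powr q)"
    by (intro mult_left_mono) (auto simp: max_def)
  finally show ?thesis .
qed

text \<open>On a bounded interval constants are integrable, and \<open>\<bar>f t\<bar>\<close> is
  dominated by \<open>1 + \<bar>f t\<bar> powr q\<close>.\<close>

lemma absolutely_integrable_of_powr:
  fixes f :: "real \<Rightarrow> real"
  assumes "1 \<le> q" "f \<in> borel_measurable (lebesgue_on {a..b})"
    and "(\<lambda>t. \<bar>f t\<bar> powr q) absolutely_integrable_on {a..b}"
  shows "f absolutely_integrable_on {a..b}"
proof (rule measurable_bounded_by_integrable_imp_absolutely_integrable)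
  show "(\<lambda>t. 1 + \<bar>f t\<bar> powr q) integrable_on {a..b}"
    using assms(3) by (intro integrable_add integrable_const_ivl) (simp add: absolutely_integrable_on_def)
  show "norm (f t) \<le> 1 + \<bar>f t\<bar> powr q" for t
  proof (cases "\<bar>f t\<bar> \<le> 1")
    case True
    then show ?thesis using powr_ge_zero[of "\<bar>f t\<bar>" q] by (simp del: powr_ge_zero)
  next
    case False
    then have "\<bar>f t\<bar> powr 1 \<le> \<bar>f t\<bar> powr q" using assms(1) by (intro powr_mono) auto
    then show ?thesis using False by simp
  qed
qed (use assms in auto)

lemma integral_small_at_Lebesgue_point:
  fixes f :: "real \<Rightarrow> real"
  assumes per: "\<And>x. f (x + 2 * pi) = f x" and "1 \<le> q"
    and meas: "f \<in> borel_measurable (lebesgue_on {-pi..pi})"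
    and powr: "(\<lambda>t. \<bar>f t\<bar> powr q) absolutely_integrable_on {-pi..pi}"
    and lim: "((\<lambda>h. 1 / (2 * h) * (LINT t|lebesgue_on {-h..h}. \<bar>f (x + t) - f x\<bar> powr q)) \<longlongrightarrow> 0) (at_right 0)"
    and "0 < \<delta>"
  shows "\<exists>\<eta>>0. \<forall>h. 0 < h \<and> h \<le> \<eta> \<longrightarrow> integral {-h..h} (\<lambda>t. \<bar>f (x + t) - f x\<bar>) \<le> \<delta> * h"
proof -
  define g where "g = (\<lambda>t. \<bar>f (x + t) - f x\<bar>)"
  have f: "f absolutely_integrable_on {-pi..pi}"
    using absolutely_integrable_of_powr[OF \<open>1 \<le> q\<close> meas powr] .
  have shift: "(\<lambda>t. F (x + t)) absolutely_integrable_on {-h..h}"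
    if "\<And>x. F (x + 2 * pi) = F x" "F absolutely_integrable_on {-pi..pi}" for F :: "real \<Rightarrow> real" and h
    using absolutely_integrable_shift_real_ivl[OF absolutely_integrable_periodic[OF that, of "x - h" "x + h"], of x]
    by (simp add: add.commute)
  have f': "(\<lambda>t. f (x + t)) absolutely_integrable_on {-h..h}" for h
    using shift[OF per f] .
  have f'': "(\<lambda>t. \<bar>f (x + t)\<bar> powr q) absolutely_integrable_on {-h..h}" for h
    using shift[of "\<lambda>t. \<bar>f t\<bar> powr q" h] powr by (simp add: per)
  have g: "g absolutely_integrable_on {-h..h}" for h
    unfolding g_def
    by (intro set_integrable_abs set_integral_diff(1)[OF f'] absolutely_integrable_continuous_real continuous_intros)
  have gq: "(\<lambda>t. g t powr q) absolutely_integrable_on {-h..h}" for h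
  proof (rule measurable_bounded_by_integrable_imp_absolutely_integrable)
    have "g \<in> borel_measurable (lebesgue_on {-h..h})"
      using g by (intro absolutely_integrable_imp_borel_measurable) auto
    then show "(\<lambda>t. g t powr q) \<in> borel_measurable (lebesgue_on {-h..h})"
      by measurable
    show "(\<lambda>t. 2 powr q * (\<bar>f (x + t)\<bar> powr q + \<bar>f x\<bar> powr q)) integrable_on {-h..h}"
      using f''[of h] unfolding absolutely_integrable_on_def
      by (intro integrable_on_mult_right integrable_add integrable_const_ivl) auto
    show "norm (g t powr q) \<le> 2 powr q * (\<bar>f (x + t)\<bar> powr q + \<bar>f x\<bar> powr q)" for t
      using abs_diff_powr_le[of q "f (x + t)" "f x"] \<open>1 \<le> q\<close> by (simp add: g_def)
  qed auto
  \<comment> \<open>Both terms of the splitting below integrate to at most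
    \<open>a * (2 * h)\<close>, which is half of \<open>\<delta> * h\<close>.\<close>
  define a where "a = \<delta> / 4"
  have "0 < a" using \<open>0 < \<delta>\<close> by (simp add: a_def)
  \<comment> \<open>a Chebyshev-type substitute for the power mean inequality: split according to \<open>g t \<le> a\<close>\<close>
  have le: "g t \<le> a + a powr (1 - q) * g t powr q" for t
  proof (cases "g t \<le> a")
    case True
    then show ?thesis using \<open>0 < a\<close> by (simp add: add_increasing2)
  next
    case False
    then have "g t powr (1 - q) \<le> a powr (1 - q)"
      using \<open>0 < a\<close> \<open>1 \<le> q\<close> by (intro powr_mono2') auto
    then have "g t powr (1 - q) * g t powr q \<le> a powr (1 - q) * g t powr q"
      by (intro mult_right_mono) auto
    moreover have "g t powr (1 - q) * g t powr q = g t"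
      using False \<open>0 < a\<close> by (simp flip: powr_add)
    ultimately show ?thesis using \<open>0 < a\<close> by linarith
  qed
  \<comment> \<open>The level \<open>a powr q\<close> is chosen so that the factor
    \<open>a powr (1 - q)\<close> brings it back to \<open>a\<close>.\<close>
  have "\<forall>\<^sub>F h in at_right 0. 1 / (2 * h) * (LINT t|lebesgue_on {-h..h}. \<bar>f (x + t) - f x\<bar> powr q) < a powr q"
    using order_tendstoD(2)[OF lim] \<open>0 < a\<close> by simp
  then obtain b where b: "b > 0" "\<And>h. 0 < h \<Longrightarrow> h < b \<Longrightarrow>
      1 / (2 * h) * (LINT t|lebesgue_on {-h..h}. \<bar>f (x + t) - f x\<bar> powr q) < a powr q"
    unfolding eventually_at_right_field by auto
  have "integral {-h..h} g \<le> \<delta> * h" if h: "0 < h" "h < b" for h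
  proof -
    have "(LINT t|lebesgue_on {-h..h}. \<bar>f (x + t) - f x\<bar> powr q) = integral {-h..h} (\<lambda>t. g t powr q)"
      using gq[of h] unfolding g_def
      by (intro lebesgue_integral_eq_integral absolutely_integrable_imp_integrable) auto
    then have "integral {-h..h} (\<lambda>t. g t powr q) \<le> a powr q * (2 * h)"
      using b(2)[OF h] h by (simp add: field_simps)
    moreover have "integral {-h..h} g \<le> integral {-h..h} (\<lambda>t. a + a powr (1 - q) * g t powr q)"
      using g[of h] gq[of h] le unfolding absolutely_integrable_on_def
      by (intro integral_le integrable_add integrable_on_mult_right integrable_const_ivl) auto
    moreover have "integral {-h..h} (\<lambda>t. a + a powr (1 - q) * g t powr q)
        = a * (2 * h) + a powr (1 - q) * integral {-h..h} (\<lambda>t. g t powr q)"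
      using gq[of h] h unfolding absolutely_integrable_on_def
      by (subst Henstock_Kurzweil_Integration.integral_add) (auto intro!: integrable_on_mult_right)
    ultimately have "integral {-h..h} g \<le> a * (2 * h) + a powr (1 - q) * (a powr q * (2 * h))"
      using mult_left_mono[of _ _ "a powr (1 - q)"] by (smt (verit) powr_ge_zero)
    also have "a powr (1 - q) * (a powr q * (2 * h)) = a * (2 * h)"
      using \<open>0 < a\<close> by (simp flip: powr_add mult.assoc)
    finally show ?thesis by (simp add: a_def)
  qed
  then show ?thesis
    unfolding g_def using b(1) by (intro exI[of _ "b / 2"]) auto
qed

section \<open>The two kinds of points combined, and the sequence of errors\<close>

theorem corollary1:
  fixes p :: ennreal and f :: "real \<Rightarrow> real" and x :: real
  assumes "1 \<le> p"
    and "f \<in> X_space p"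
    and "X_point p f x"
  shows "\<exists>\<epsilon> :: nat \<Rightarrow> real. \<epsilon> \<longlonglongrightarrow> 0 \<and>
    (\<forall>m n :: nat. 1 \<le> m \<and> m \<le> n \<longrightarrow>
       \<bar>vallee_poussin_mean n m f x - f x\<bar> \<le> \<epsilon> n * (1 + ln ((real n + 1) / (real m + 1))))"
proof -
  have per: "\<And>x. f (x + 2 * pi) = f x" using assms(2) by (simp add: X_space_def)
  have "f absolutely_integrable_on {-pi..pi} \<and> (\<forall>\<delta>>0.
      \<exists>\<eta>>0. \<forall>h. 0 < h \<and> h \<le> \<eta> \<longrightarrow> integral {-h..h} (\<lambda>t. \<bar>f (x + t) - f x\<bar>) \<le> \<delta> * h)"
  proof (cases "p = \<infinity>")
    case True
    then have "continuous_on UNIV f" using assms(2) by (simp add: X_space_def)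
    then show ?thesis
      by (auto intro: integral_small_at_continuity_point absolutely_integrable_continuous_real continuous_on_subset)
  next
    case False
    let ?q = "enn2real p"
    have "1 \<le> ?q"
      using enn2real_mono[of 1 p] assms(1) False by (simp add: top.not_eq_extremum)
    have meas: "f \<in> borel_measurable (lebesgue_on {-pi..pi})"
      and int: "integrable (lebesgue_on {-pi..pi}) (\<lambda>t. \<bar>f t\<bar> powr ?q)"
      using assms(2) False by (auto simp: X_space_def)
    have "(\<lambda>t. \<bar>f t\<bar> powr ?q) absolutely_integrable_on {-pi..pi}"
      using integrable_on_lebesgue_on[OF int] by (subst absolutely_integrable_on_iff_nonneg) auto
    moreover have "((\<lambda>h. 1 / (2 * h) * (LINT t|lebesgue_on {-h..h}. \<bar>f (x + t) - f x\<bar> powr ?q)) \<longlongrightarrow> 0) (at_right 0)"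
      using assms(3) False by (simp add: X_point_def)
    ultimately show ?thesis
      using integral_small_at_Lebesgue_point[OF per \<open>1 \<le> ?q\<close> meas] absolutely_integrable_of_powr[OF \<open>1 \<le> ?q\<close> meas]
      by blast
  qed
  then have small: "\<exists>n0. \<forall>n\<ge>n0. \<forall>m\<le>n.
      \<bar>vallee_poussin_mean n m f x - f x\<bar> \<le> e * (1 + ln ((real n + 1) / (real m + 1)))" if "0 < e" for e
    using that per by (intro vallee_poussin_mean_small) auto
  define \<Lambda> where "\<Lambda> n m = 1 + ln ((real n + 1) / (real m + 1))" for n m :: nat
  define r where "r n m = \<bar>vallee_poussin_mean n m f x - f x\<bar> / \<Lambda> n m" for n m
  \<comment> \<open>The worst weighted error over all \<open>m \<le> n\<close>: it depends on
    \<open>n\<close> alone and tends to \<open>0\<close> because \<open>small\<close> is uniform in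
    \<open>m\<close>.\<close>
  define \<epsilon> where "\<epsilon> n = Max (r n ` {..n})" for n
  have \<Lambda>: "0 < \<Lambda> n m" if "m \<le> n" for n m
    using that by (simp add: \<Lambda>_def add_pos_nonneg)
  have r_le: "r n m \<le> \<epsilon> n" if "m \<le> n" for n m
    unfolding \<epsilon>_def using that by (intro Max_ge) auto
  have "\<epsilon> \<longlonglongrightarrow> 0"
  proof (rule LIMSEQ_I)
    fix e :: real assume "0 < e"
    obtain n0 where n0: "\<And>n m. n \<ge> n0 \<Longrightarrow> m \<le> n \<Longrightarrow>
        \<bar>vallee_poussin_mean n m f x - f x\<bar> \<le> e / 2 * \<Lambda> n m"
      using small[of "e / 2"] \<open>0 < e\<close> by (auto simp: \<Lambda>_def)
    have "norm (\<epsilon> n - 0) < e" if "n \<ge> n0" for n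
    proof -
      have "r n m \<le> e / 2" if "m \<le> n" for m
        using n0[OF \<open>n \<ge> n0\<close> that] \<Lambda>[OF that] by (simp add: r_def divide_le_eq)
      then have "\<epsilon> n \<le> e / 2"
        unfolding \<epsilon>_def by (subst Max_le_iff) auto
      \<comment> \<open>One nonnegative member makes the maximum nonnegative, so the upper bound
        controls its norm.\<close>
      moreover have "0 \<le> r n 0"
        using \<Lambda>[of 0 n] by (simp add: r_def)
      ultimately show ?thesis
        using r_le[of 0 n] \<open>0 < e\<close> by simp
    qed
    then show "\<exists>no. \<forall>n\<ge>no. norm (\<epsilon> n - 0) < e" by blast
  qed
  moreover have "\<bar>vallee_poussin_mean n m f x - f x\<bar> \<le> \<epsilon> n * \<Lambda> n m" if "m \<le> n" for n m
    using r_le[OF that] \<Lambda>[OF that] by (simp add: r_def divide_le_eq)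
  ultimately show ?thesis
    unfolding \<Lambda>_def by blast
qed

end
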